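(* Let $d\in\mathbb{N}$, let $\boldsymbol{b}=(b_1,\dots,b_d)$ with integers $b_j\ge 2$, and let $\mathcal{S}=\{\boldsymbol{x}_0,\boldsymbol{x}_1,\dots\}\subset[0,1)^d$ be a $(\boldsymbol{0},d)$-sequence in base $\boldsymbol{b}$. Let $n\in\mathbb{N}$ and $P_n=\{\boldsymbol{x}_0,\dots,\boldsymbol{x}_{n-1}\}$. Then for any $\emptyset\ne v\subseteq u\subseteq\{1,\dots,d\}$ and any $\boldsymbol{k}=(k_j)_{j\in u}\in\mathbb{N}_0^{|u|}$ the following hold. (i) With $m_{u,v,\boldsymbol{k}}=\prod_{j\in v}b_j^{k_j+1}\prod_{j\in u\setminus v}b_j^{k_j}$, $$C_{u,v,\boldsymbol{k}}(P_n)=n+(2n-m_{u,v,\boldsymbol{k}})\left\lfloor\frac{n}{m_{u,v,\boldsymbol{k}}}\right\rfloor-m_{u,v,\boldsymbol{k}}\left\lfloor\frac{n}{m_{u,v,\boldsymbol{k}}}\right\rfloor^2 .$$ (ii) For fixed $\boldsymbol{b},u,v,\boldsymbol{k}$, the values $G_{u,\boldsymbol{k}}(P_n)$, $\widetilde G_{u,\boldsymbol{k}}(P_n)$ and $C_{u,v,\boldsymbol{k}}(P_n)$ are determined solely by $n$ (i.e. they are the same for every $(\boldsymbol{0},d)$-sequence in base $\boldsymbol{b}$).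
   Context: $\mathbb{N}$ is the set of positive integers, $\mathbb{N}_0=\mathbb{N}\cup\{0\}$, and $\chi(A)$ is the indicator of $A$. For $\boldsymbol{k}\in\mathbb{N}_0^d$, an elementary $(k_1,\dots,k_d)$-interval in base $\boldsymbol{b}=(b_1,\dots,b_d)$ is a set $\prod_{j=1}^d[a_jb_j^{-k_j},(a_j+1)b_j^{-k_j})$ with integers $0\le a_j<b_j^{k_j}$. A sequence $(\boldsymbol{x}_i)_{i\ge0}$ in $[0,1)^d$ is a $(\boldsymbol{0},d)$-sequence in base $\boldsymbol{b}$ if for every $r\in\mathbb{N}_0$ and every $\boldsymbol{k}\in\mathbb{N}_0^d$, with $B=\prod_{j=1}^d b_j^{k_j}$, every elementary $(k_1,\dots,k_d)$-interval in base $\boldsymbol{b}$ contains exactly one of the points $\boldsymbol{x}_{rB},\dots,\boldsymbol{x}_{(r+1)B-1}$. Write $x_{i,j}$ for the $j$th coordinate of $\boldsymbol{x}_i$. For $P_n=\{\boldsymbol{x}_0,\dots,\boldsymbol{x}_{n-1}\}$, $\emptyset\neq u\subseteq\{1,\dots,d\}$, $v\subseteq u$ and $\boldsymbol{k}\in\mathbb{N}_0^{|u|}$ (indexed by $u$): - $C_{u,v,\boldsymbol{k}}(P_n)$ is the number of pairs $(i,i')\in\{0,\dots,n-1\}^2$ such that the projections of $\boldsymbol{x}_i$ and $\boldsymbol{x}_{i'}$ onto the coordinates in $u$ lie in the same elementary $(\ell_j)_{j\in u}$-interval in base $(b_j)_{j\in u}$, where $\ell_j=k_j+1$ for $j\in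 v$ and $\ell_j=k_j$ for $j\in u\setminus v$; i.e. $\lfloor b_j^{\ell_j}x_{i,j}\rfloor=\lfloor b_j^{\ell_j}x_{i',j}\rfloor$ for all $j\in u$. - $\widetilde G_{u,\boldsymbol{k}}(P_n)=\sum_{i=0}^{n-1}\sum_{i'=0}^{n-1}\prod_{j\in u}\bigl(b_j\chi(\lfloor b_j^{k_j+1}x_{i,j}\rfloor=\lfloor b_j^{k_j+1}x_{i',j}\rfloor)-\chi(\lfloor b_j^{k_j}x_{i,j}\rfloor=\lfloor b_j^{k_j}x_{i',j}\rfloor)\bigr)$. - The gain coefficient is $G_{u,\boldsymbol{k}}(P_n)=\frac1n\prod_{j\in u}(b_j-1)^{-1}\,\widetilde G_{u,\boldsymbol{k}}(P_n)$. *)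

theory Defs
  imports "HOL-Analysis.Analysis"
begin

text \<open>
  Points of \<open>[0,1)^J\<close>, for a finite set \<open>J\<close> of coordinates, are extensional functions
  in \<open>J \<rightarrow>\<^sub>E {0..<1}\<close>; the full space has \<open>J = {1..d}\<close>, and the projection
  onto the coordinates in \<open>u\<close> is \<open>\<lambda>p. restrict p u\<close>. Bases \<open>b\<close> and exponents \<open>k\<close>
  are total functions on the coordinates; only their values on \<open>J\<close> matter.
\<close>

definition elementary_intervals ::
    "nat set \<Rightarrow> (nat \<Rightarrow> nat) \<Rightarrow> (nat \<Rightarrow> nat) \<Rightarrow> (nat \<Rightarrow> real) set set" where
  "elementary_intervals J b k =
     {(\<Pi>\<^sub>E j\<in>J. {real (a j) / real (b j) ^ k j ..< (real (a j) + 1) / real (b j) ^ k j}) | a.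
        \<forall>j\<in>J. a j < b j ^ k j}"

definition zero_sequence :: "nat \<Rightarrow> (nat \<Rightarrow> nat) \<Rightarrow> (nat \<Rightarrow> nat \<Rightarrow> real) \<Rightarrow> bool" where
  "zero_sequence d b x \<longleftrightarrow>
     (\<forall>i. x i \<in> {1..d} \<rightarrow>\<^sub>E {0..<1}) \<and>
     (\<forall>(r::nat) k. let B = (\<Prod>j\<in>{1..d}. b j ^ k j) in
        \<forall>E \<in> elementary_intervals {1..d} b k. \<exists>!i. i \<in> {r * B ..< (r + 1) * B} \<and> x i \<in> E)"

text \<open>
  The point set \<open>P\<^sub>n\<close> is given by the sequence \<open>x\<close> together with \<open>n\<close>; pairs of points are
  counted as pairs of indices below \<open>n\<close>.
\<close>

definition C_count ::
    "(nat \<Rightarrow> nat) \<Rightarrow> nat set \<Rightarrow> nat set \<Rightarrow> (nat \<Rightarrow> nat) \<Rightarrow> (nat \<Rightarrow> nat \<Rightarrow> real) \<Rightarrow> nat \<Rightarrow> nat" where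
  "C_count b u v k x n =
     card {(i, i'). i < n \<and> i' < n \<and>
       (\<exists>E \<in> elementary_intervals u b (\<lambda>j. if j \<in> v then k j + 1 else k j).
          restrict (x i) u \<in> E \<and> restrict (x i') u \<in> E)}"

definition G_tilde ::
    "(nat \<Rightarrow> nat) \<Rightarrow> nat set \<Rightarrow> (nat \<Rightarrow> nat) \<Rightarrow> (nat \<Rightarrow> nat \<Rightarrow> real) \<Rightarrow> nat \<Rightarrow> real" where
  "G_tilde b u k x n =
     (\<Sum>i<n. \<Sum>i'<n. \<Prod>j\<in>u.
        real (b j) * of_bool (\<lfloor>real (b j) ^ (k j + 1) * x i j\<rfloor> = \<lfloor>real (b j) ^ (k j + 1) * x i' j\<rfloor>)
        - of_bool (\<lfloor>real (b j) ^ k j * x i j\<rfloor> = \<lfloor>real (b j) ^ k j * x i' j\<rfloor>))"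

definition gain_coefficient ::
    "(nat \<Rightarrow> nat) \<Rightarrow> nat set \<Rightarrow> (nat \<Rightarrow> nat) \<Rightarrow> (nat \<Rightarrow> nat \<Rightarrow> real) \<Rightarrow> nat \<Rightarrow> real" where
  "gain_coefficient b u k x n =
     1 / real n * (\<Prod>j\<in>u. inverse (real (b j) - 1)) * G_tilde b u k x n"

end

theory Submission
  imports Defs
begin

text \<open>
  Fix exponents \<open>l\<^sub>j\<close> for \<open>j \<in> u\<close> and let \<open>m = (\<Prod>j\<in>u. b\<^sub>j ^ l\<^sub>j)\<close> be the number of cells of the
  grid that they cut out in the coordinates \<open>u\<close>. With exponent \<open>0\<close> outside \<open>u\<close>, every cell is the
  projection of an elementary interval of the full space, so the net property says that each block
  \<open>{r * m ..< (r + 1) * m}\<close> of indices visits each cell exactly once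
  (\<open>cell_unique_in_block\<close>). Hence the cell of the point with index \<open>i\<close> has been visited exactly
  \<open>i div m\<close> times before time \<open>i\<close>: once in every complete block, and not yet in the
  current one. Adding that point to the first \<open>i\<close> points therefore creates \<open>2 * (i div m) + 1\<close> new ordered
  pairs in a common cell, whatever the sequence is, and summing over \<open>i < n\<close> gives the closed
  formula for the pair count (\<open>card_equal_pairs\<close>, \<open>C_count_formula\<close>).

  For the gain coefficients, the product over \<open>j \<in> u\<close> in the definition is multiplied out. Each
  resulting term belongs to a subset \<open>w\<close> of \<open>u\<close>, the coordinates at the finer resolution, and
  summed over all pairs of points it is a constant multiple of the pair count for \<open>w\<close>
  (\<open>G_tilde_eq_sum_C_count\<close>). This needs the pair counts for \<open>w = {}\<close> too, and
  \<open>C_count_formula\<close> includes them.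
\<close>

section \<open>Pairs of equal values in block-balanced sequences\<close>

text \<open>
  Since \<open>i div m\<close> is the block of \<open>i\<close>, the hypothesis says that the value \<open>f n\<close> occurs exactly once
  in each block. Its occurrences before \<open>n\<close> correspond bijectively, under \<open>i \<mapsto> i div m\<close>, to the
  complete blocks before \<open>n\<close>, because the one occurrence in the block of \<open>n\<close> is \<open>n\<close> itself.
\<close>

lemma card_previous_occurrences:
  fixes f :: "nat \<Rightarrow> 'a"
  assumes m: "m > 0" and ex1: "\<And>r. \<exists>!i. i div m = r \<and> f i = f n"
  shows "card {i. i < n \<and> f i = f n} = n div m"
proof -
  have uniq: "i = i'" if "f i = f n" "f i' = f n" "i div m = i' div m" for i i'
    using ex1[of "i div m"] that by metis
  have "bij_betw (\<lambda>i. i div m) {i. i < n \<and> f i = f n} {..<n div m}"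
  proof (rule bij_betwI')
    fix i i' assume "i \<in> {i. i < n \<and> f i = f n}" "i' \<in> {i. i < n \<and> f i = f n}"
    then show "(i div m = i' div m) = (i = i')"
      using uniq by blast
  next
    fix i assume "i \<in> {i. i < n \<and> f i = f n}"
    then have "i < n" "f i = f n" by auto
    then have "i div m \<le> n div m" "i div m \<noteq> n div m"
      using uniq[of i n] by (auto intro: div_le_mono)
    then show "i div m \<in> {..<n div m}" by simp
  next
    fix r assume r: "r \<in> {..<n div m}"
    obtain i where i: "i div m = r" "f i = f n" using ex1[of r] by blast
    have "i < n"
      using i r by (metis div_le_mono lessThan_iff not_le)
    then show "\<exists>i\<in>{i. i < n \<and> f i = f n}. r = i div m"
      using i by blast
  qed
  then show ?thesis
    using bij_betw_same_card by fastforce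
qed

lemma card_equal_pairs_Suc:
  fixes f :: "nat \<Rightarrow> 'a"
  shows "card {(i, i'). i < Suc n \<and> i' < Suc n \<and> f i = f i'} =
    card {(i, i'). i < n \<and> i' < n \<and> f i = f i'} + 2 * card {i. i < n \<and> f i = f n} + 1"
proof -
  let ?P = "{(i, i'). i < n \<and> i' < n \<and> f i = f i'}"
  let ?N = "{i. i < n \<and> f i = f n}"
  let ?L = "insert (n, n) ((\<lambda>i. (n, i)) ` ?N)" and ?R = "(\<lambda>i. (i, n)) ` ?N"
  have fin: "finite ?P"
    by (rule finite_subset[of _ "{..<n} \<times> {..<n}"]) auto
  have split: "{(i, i'). i < Suc n \<and> i' < Suc n \<and> f i = f i'} = ?P \<union> (?L \<union> ?R)"
    by (auto simp: less_Suc_eq image_iff)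
  have "card (?P \<union> (?L \<union> ?R)) = card ?P + card (?L \<union> ?R)"
  proof (rule card_Un_disjoint[OF fin])
    show "finite (?L \<union> ?R)" by simp
    show "?P \<inter> (?L \<union> ?R) = {}" by blast
  qed
  moreover have "card (?L \<union> ?R) = card ?L + card ?R"
  proof (rule card_Un_disjoint)
    show "?L \<inter> ?R = {}" by blast
  qed simp_all
  moreover have "card ?L = Suc (card ((\<lambda>i. (n, i)) ` ?N))"
    by (rule card_insert_disjoint) auto
  moreover have "card ((\<lambda>i. (n, i)) ` ?N) = card ?N" "card ?R = card ?N"
    by (simp_all add: card_image inj_on_def)
  ultimately show ?thesis
    unfolding split by linarith
qed

lemma card_equal_pairs:
  fixes f :: "nat \<Rightarrow> 'a"
  assumes m: "m > 0" and ex1: "\<And>r i'. \<exists>!i. i div m = r \<and> f i = f i'"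
  shows "int (card {(i, i'). i < n \<and> i' < n \<and> f i = f i'}) =
    int n + (2 * int n - int m) * int (n div m) - int m * int (n div m) ^ 2"
proof (induction n)
  case 0
  then show ?case by simp
next
  case (Suc n)
  define q where "q = int (n div m)"
  have "int (card {(i, i'). i < Suc n \<and> i' < Suc n \<and> f i = f i'}) =
      int n + (2 * int n - int m) * q - int m * q ^ 2 + 2 * q + 1"
    using Suc card_previous_occurrences[OF m, of f n] ex1
    by (simp add: card_equal_pairs_Suc q_def)
  also have "\<dots> = int (Suc n) + (2 * int (Suc n) - int m) * int (Suc n div m)
      - int m * int (Suc n div m) ^ 2"
  proof (cases "m dvd Suc n")
    case False
    then have "Suc n div m = n div m"
      by (simp add: div_Suc dvd_eq_mod_eq_0)
    then show ?thesis by (simp add: q_def algebra_simps)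
  next
    case True
    then have div: "Suc n div m = Suc (n div m)"
      by (simp add: div_Suc dvd_eq_mod_eq_0)
    then have "Suc n = m * Suc (n div m)"
      using True by (metis dvd_mult_div_cancel)
    then have n: "int n = int m * (q + 1) - 1"
      unfolding q_def by (metis add_diff_cancel_left' of_nat_Suc of_nat_mult add.commute)
    \<comment> \<open>The quotient jumps here, but the closed form does not: at \<open>Suc n = m * (q + 1)\<close>
      the quotients \<open>q\<close> and \<open>q + 1\<close> give the same value.\<close>
    show ?thesis
      using div by (simp add: q_def[symmetric] n algebra_simps power2_eq_square)
  qed
  finally show ?case .
qed

section \<open>Cells of the elementary grid\<close>

definition cell :: "nat set \<Rightarrow> (nat \<Rightarrow> nat) \<Rightarrow> (nat \<Rightarrow> nat) \<Rightarrow> (nat \<Rightarrow> real) \<Rightarrow> nat \<Rightarrow> nat" where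
  "cell J b l z = (\<lambda>j\<in>J. nat \<lfloor>real (b j) ^ l j * z j\<rfloor>)"

lemma cell_eq_iff_floor_eq:
  assumes "\<forall>j\<in>J. 0 \<le> z j" "\<forall>j\<in>J. 0 \<le> z' j"
  shows "cell J b l z = cell J b l z' \<longleftrightarrow>
    (\<forall>j\<in>J. \<lfloor>real (b j) ^ l j * z j\<rfloor> = \<lfloor>real (b j) ^ l j * z' j\<rfloor>)"
proof -
  have "cell J b l z = cell J b l z' \<longleftrightarrow>
      (\<forall>j\<in>J. nat \<lfloor>real (b j) ^ l j * z j\<rfloor> = nat \<lfloor>real (b j) ^ l j * z' j\<rfloor>)"
    by (auto simp: cell_def restrict_def fun_eq_iff)
  then show ?thesis
    using assms by (simp add: eq_nat_nat_iff)
qed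

lemma mem_scaled_interval_iff:
  fixes z B :: real
  assumes "B > 0" "z \<ge> 0"
  shows "z \<in> {real a / B ..< (real a + 1) / B} \<longleftrightarrow> nat \<lfloor>B * z\<rfloor> = a"
proof -
  have "z \<in> {real a / B ..< (real a + 1) / B} \<longleftrightarrow> \<lfloor>B * z\<rfloor> = int a"
    using assms by (simp add: floor_eq_iff field_simps)
  moreover have "\<lfloor>B * z\<rfloor> \<ge> 0" using assms by simp
  ultimately show ?thesis by linarith
qed

lemma cell_bound:
  assumes "b j > 0" "0 \<le> z j" "z j < 1" "j \<in> J"
  shows "cell J b l z j < b j ^ l j"
proof -
  have "real (b j) ^ l j * z j < real (b j) ^ l j * 1"
    using assms by (intro mult_strict_left_mono) auto
  then have "\<lfloor>real (b j) ^ l j * z j\<rfloor> < int (b j ^ l j)"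
    by (simp add: floor_less_iff)
  then show ?thesis
    using assms by (simp add: cell_def nat_less_iff)
qed

lemma same_elementary_interval_iff:
  assumes b: "\<forall>j\<in>J. b j > 0"
    and z: "\<forall>j\<in>J. 0 \<le> z j \<and> z j < 1" and z': "\<forall>j\<in>J. 0 \<le> z' j \<and> z' j < 1"
  shows "(\<exists>E\<in>elementary_intervals J b l. restrict z J \<in> E \<and> restrict z' J \<in> E) \<longleftrightarrow>
    cell J b l z = cell J b l z'"
proof -
  let ?E = "\<lambda>a. \<Pi>\<^sub>E j\<in>J. {real (a j) / real (b j) ^ l j ..< (real (a j) + 1) / real (b j) ^ l j}"
  have mem: "restrict p J \<in> ?E a \<longleftrightarrow> (\<forall>j\<in>J. cell J b l p j = a j)"
    if "\<forall>j\<in>J. 0 \<le> p j \<and> p j < 1" for p a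
    using that b by (simp add: restrict_PiE_iff Pi_iff mem_scaled_interval_iff cell_def
      del: atLeastLessThan_iff)
  have "(\<exists>E\<in>elementary_intervals J b l. restrict z J \<in> E \<and> restrict z' J \<in> E) \<longleftrightarrow>
      (\<exists>a. (\<forall>j\<in>J. a j < b j ^ l j) \<and> restrict z J \<in> ?E a \<and> restrict z' J \<in> ?E a)"
    unfolding elementary_intervals_def by (simp only: Bex_def mem_Collect_eq) iprover
  also have "\<dots> \<longleftrightarrow> (\<exists>a. (\<forall>j\<in>J. a j < b j ^ l j) \<and> (\<forall>j\<in>J. cell J b l z j = a j) \<and>
        (\<forall>j\<in>J. cell J b l z' j = a j))"
    by (simp only: mem[OF z] mem[OF z'])
  also have "\<dots> \<longleftrightarrow> (\<forall>j\<in>J. cell J b l z j = cell J b l z' j)"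
    using cell_bound[of b _ z J l] b z by (metis (no_types, lifting))
  also have "\<dots> \<longleftrightarrow> cell J b l z = cell J b l z'"
    by (auto simp: cell_def fun_eq_iff)
  finally show ?thesis .
qed

section \<open>Pair counts of a zero sequence\<close>

lemma zero_sequence_bounds:
  assumes "zero_sequence d b x" "u \<subseteq> {1..d}"
  shows "\<forall>j\<in>u. 0 \<le> x i j \<and> x i j < 1"
proof -
  have "x i \<in> {1..d} \<rightarrow>\<^sub>E {0..<1}" using assms(1) by (simp add: zero_sequence_def)
  then show ?thesis using assms(2) by (fastforce simp: PiE_iff)
qed

text \<open>
  The net property is applied to the cylinder over the given cell of the grid on \<open>u\<close>: exponent \<open>0\<close>
  outside \<open>u\<close> makes the interval there all of \<open>[0,1)\<close> and contributes the factor \<open>1\<close> to the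
  block length.
\<close>

lemma cell_unique_in_block:
  assumes b: "\<forall>j\<in>{1..d}. b j \<ge> 2" and x: "zero_sequence d b x" and u: "u \<subseteq> {1..d}"
  shows "\<exists>!i. i div (\<Prod>j\<in>u. b j ^ l j) = r \<and> cell u b l (x i) = cell u b l (x i')"
proof -
  define m where "m = (\<Prod>j\<in>u. b j ^ l j)"
  define l' where "l' = (\<lambda>j. if j \<in> u then l j else 0)"
  define a where "a = (\<lambda>j. if j \<in> u then cell u b l (x i') j else 0)"
  define E where "E = (\<Pi>\<^sub>E j\<in>{1..d}.
    {real (a j) / real (b j) ^ l' j ..< (real (a j) + 1) / real (b j) ^ l' j})"
  have pos: "\<forall>j\<in>{1..d}. b j > 0" using b by force
  have m0: "m > 0" using pos u by (auto simp: m_def intro!: prod_pos)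
  have B: "(\<Prod>j\<in>{1..d}. b j ^ l' j) = m"
    unfolding m_def using u by (intro prod.mono_neutral_cong_right) (auto simp: l'_def)
  have bounds: "\<forall>j\<in>{1..d}. 0 \<le> x i j \<and> x i j < 1" for i
    using zero_sequence_bounds[OF x] by blast
  have "\<forall>j\<in>{1..d}. a j < b j ^ l' j"
    using pos u bounds[of i'] by (auto simp: a_def l'_def intro!: cell_bound)
  then have "E \<in> elementary_intervals {1..d} b l'"
    unfolding elementary_intervals_def E_def by blast
  then have ex1: "\<exists>!i. i \<in> {r * m ..< (r + 1) * m} \<and> x i \<in> E"
    using x unfolding zero_sequence_def Let_def by (metis B)
  have mem: "x i \<in> E \<longleftrightarrow> cell u b l (x i) = cell u b l (x i')" for i
  proof -
    have "x i \<in> extensional {1..d}" using x by (auto simp: zero_sequence_def PiE_iff)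
    then have "x i \<in> E \<longleftrightarrow> (\<forall>j\<in>{1..d}. nat \<lfloor>real (b j) ^ l' j * x i j\<rfloor> = a j)"
      using pos bounds[of i]
      by (simp add: E_def PiE_iff mem_scaled_interval_iff del: atLeastLessThan_iff)
    also have "\<dots> \<longleftrightarrow> (\<forall>j\<in>u. cell u b l (x i) j = cell u b l (x i') j)"
      using u bounds[of i] by (force simp: a_def l'_def cell_def floor_eq_iff split: if_splits)
    also have "\<dots> \<longleftrightarrow> cell u b l (x i) = cell u b l (x i')"
      by (auto simp: cell_def fun_eq_iff)
    finally show ?thesis .
  qed
  have "i \<in> {r * m ..< (r + 1) * m} \<longleftrightarrow> i div m = r" for i
    using less_eq_div_iff_mult_less_eq[OF m0, of r i] div_less_iff_less_mult[OF m0, of i "r + 1"]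
    by auto
  then show ?thesis
    using ex1 mem unfolding m_def by simp
qed

lemma C_count_eq_card_cell:
  fixes k :: "nat \<Rightarrow> nat"
  assumes b: "\<forall>j\<in>{1..d}. b j \<ge> 2" and x: "zero_sequence d b x" and u: "u \<subseteq> {1..d}"
  defines "l \<equiv> \<lambda>v j. if j \<in> v then k j + 1 else k j"
  shows "C_count b u v k x n =
    card {(i, i'). i < n \<and> i' < n \<and> cell u b (l v) (x i) = cell u b (l v) (x i')}"
proof -
  have "\<forall>j\<in>u. b j > 0" using b u by force
  then show ?thesis
    unfolding C_count_def l_def
    using same_elementary_interval_iff[of u b] zero_sequence_bounds[OF x u] by simp
qed

lemma C_count_formula:
  fixes k :: "nat \<Rightarrow> nat"
  assumes b: "\<forall>j\<in>{1..d}. b j \<ge> 2" and x: "zero_sequence d b x"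
    and v: "v \<subseteq> u" and u: "u \<subseteq> {1..d}"
  defines "m \<equiv> (\<Prod>j\<in>v. b j ^ (k j + 1)) * (\<Prod>j\<in>u - v. b j ^ k j)"
  shows "int (C_count b u v k x n) =
    int n + (2 * int n - int m) * int (n div m) - int m * int (n div m) ^ 2"
proof -
  define l where "l = (\<lambda>j. if j \<in> v then k j + 1 else k j)"
  have fin: "finite u" using u finite_subset by blast
  have "(\<Prod>j\<in>u. b j ^ l j) = (\<Prod>j\<in>u - v. b j ^ l j) * (\<Prod>j\<in>v. b j ^ l j)"
    using v fin by (rule prod.subset_diff)
  also have "\<dots> = m"
    by (simp add: m_def l_def mult.commute)
  finally have m: "m = (\<Prod>j\<in>u. b j ^ l j)" ..
  have "\<forall>j\<in>u. b j > 0" using b u by force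
  then have "m > 0" by (auto simp: m intro!: prod_pos)
  then have "int (card {(i, i'). i < n \<and> i' < n \<and> cell u b l (x i) = cell u b l (x i')}) =
      int n + (2 * int n - int m) * int (n div m) - int m * int (n div m) ^ 2"
    using cell_unique_in_block[OF b x u] unfolding m by (intro card_equal_pairs)
  then show ?thesis
    using C_count_eq_card_cell[OF b x u] by (simp add: l_def)
qed

section \<open>Gain coefficients as combinations of pair counts\<close>

lemma prod_of_bool:
  "finite A \<Longrightarrow> (\<Prod>j\<in>A. of_bool (P j)) = (of_bool (\<forall>j\<in>A. P j) :: 'a :: comm_semiring_1)"
  by (induction A rule: finite_induct) auto

text \<open>
  In the expansion of the product, \<open>w\<close> is the set of coordinates in which the first term, at
  resolution \<open>k j + 1\<close>, was chosen. The product of the chosen indicators is the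
  indicator of lying in a common cell for the exponents that \<open>w\<close> prescribes.
\<close>

lemma G_tilde_eq_sum_C_count:
  assumes b: "\<forall>j\<in>{1..d}. b j \<ge> 2" and x: "zero_sequence d b x" and u: "u \<subseteq> {1..d}"
  shows "G_tilde b u k x n =
    (\<Sum>w\<in>Pow u. (\<Prod>j\<in>w. real (b j)) * (- 1) ^ (card u - card w) * real (C_count b u w k x n))"
proof -
  have fin: "finite u" using u finite_subset by blast
  define l where "l = (\<lambda>w j. if j \<in> w then k j + 1 else k j)"
  define S where "S = (\<lambda>e i i' j.
    \<lfloor>real (b j) ^ e * x i j\<rfloor> = \<lfloor>real (b j) ^ e * x i' j\<rfloor>)"
  define D where "D = (\<lambda>w i i'. cell u b (l w) (x i) = cell u b (l w) (x i'))"
  define c where "c = (\<lambda>w. (\<Prod>j\<in>w. real (b j)) * (- 1) ^ (card u - card w))"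
  have expand: "(\<Prod>j\<in>u. real (b j) * of_bool (S (k j + 1) i i' j) - of_bool (S (k j) i i' j)) =
      (\<Sum>w\<in>Pow u. c w * of_bool (D w i i'))" for i i'
  proof -
    have "(\<Prod>j\<in>u. real (b j) * of_bool (S (k j + 1) i i' j) - of_bool (S (k j) i i' j)) =
        (\<Sum>w\<in>Pow u. (- 1) ^ (card u - card w) *
          (\<Prod>j\<in>w. real (b j) * of_bool (S (k j + 1) i i' j)) *
          (\<Prod>j\<in>u - w. of_bool (S (k j) i i' j)))"
      by (rule prod_diff_conv_sum'[OF fin])
    also have "\<dots> = (\<Sum>w\<in>Pow u. c w * of_bool (D w i i'))"
    proof (rule sum.cong[OF refl])
      fix w assume "w \<in> Pow u"
      then have w: "w \<subseteq> u" and finw: "finite w" using fin finite_subset by auto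
      have D: "D w i i' \<longleftrightarrow> (\<forall>j\<in>w. S (k j + 1) i i' j) \<and> (\<forall>j\<in>u - w. S (k j) i i' j)"
        using cell_eq_iff_floor_eq[of u "x i" "x i'" b "l w"] zero_sequence_bounds[OF x u] w
        unfolding D_def S_def l_def by auto
      show "(- 1) ^ (card u - card w) * (\<Prod>j\<in>w. real (b j) * of_bool (S (k j + 1) i i' j)) *
          (\<Prod>j\<in>u - w. of_bool (S (k j) i i' j)) = c w * of_bool (D w i i')"
        using fin finw by (simp add: prod.distrib prod_of_bool D c_def)
    qed
    finally show ?thesis .
  qed
  have count: "(\<Sum>i<n. \<Sum>i'<n. of_bool (D w i i')) = real (C_count b u w k x n)" for w
  proof -
    have "(\<Sum>i<n. \<Sum>i'<n. of_bool (D w i i')) =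
        (\<Sum>p\<in>{..<n} \<times> {..<n}. of_bool (D w (fst p) (snd p)) :: real)"
      by (simp only: sum.cartesian_product case_prod_unfold)
    also have "\<dots> = real (card (({..<n} \<times> {..<n}) \<inter> {p. D w (fst p) (snd p)}))"
      by (subst sum_of_bool_eq) auto
    also have "({..<n} \<times> {..<n}) \<inter> {p. D w (fst p) (snd p)} =
        {(i, i'). i < n \<and> i' < n \<and> D w i i'}"
      by auto
    also have "card \<dots> = C_count b u w k x n"
      using C_count_eq_card_cell[OF b x u] by (simp add: D_def l_def)
    finally show ?thesis .
  qed
  have "G_tilde b u k x n = (\<Sum>i<n. \<Sum>i'<n. \<Sum>w\<in>Pow u. c w * of_bool (D w i i'))"
    unfolding G_tilde_def by (simp only: expand[symmetric] S_def)
  also have "\<dots> = (\<Sum>w\<in>Pow u. \<Sum>i<n. \<Sum>i'<n. c w * of_bool (D w i i'))"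
    by (subst sum.swap[of _ "Pow u"]) (simp add: sum.swap[of _ "Pow u" "{..<n}"])
  also have "\<dots> = (\<Sum>w\<in>Pow u. c w * real (C_count b u w k x n))"
    by (simp only: sum_distrib_left[symmetric] count)
  finally show ?thesis by (simp add: c_def)
qed

section \<open>Pair counts and gain coefficients depend only on the number of points\<close>

theorem lemma3p1:
  fixes d n :: nat
    and b k :: "nat \<Rightarrow> nat"
    and x :: "nat \<Rightarrow> nat \<Rightarrow> real"
    and u v :: "nat set"
  assumes "d \<ge> 1"
    and "\<forall>j\<in>{1..d}. b j \<ge> 2"
    and "zero_sequence d b x"
    and "n \<ge> 1"
    and "v \<noteq> {}" and "v \<subseteq> u" and "u \<subseteq> {1..d}"
  shows "(let m = (\<Prod>j\<in>v. b j ^ (k j + 1)) * (\<Prod>j\<in>u - v. b j ^ k j) in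
            int (C_count b u v k x n) =
              int n + (2 * int n - int m) * \<lfloor>real n / real m\<rfloor> - int m * \<lfloor>real n / real m\<rfloor> ^ 2)
       \<and> (\<forall>y. zero_sequence d b y \<longrightarrow>
            gain_coefficient b u k y n = gain_coefficient b u k x n \<and>
            G_tilde b u k y n = G_tilde b u k x n \<and>
            C_count b u v k y n = C_count b u v k x n)"
proof (intro conjI allI impI)
  show "let m = (\<Prod>j\<in>v. b j ^ (k j + 1)) * (\<Prod>j\<in>u - v. b j ^ k j) in
            int (C_count b u v k x n) =
              int n + (2 * int n - int m) * \<lfloor>real n / real m\<rfloor> - int m * \<lfloor>real n / real m\<rfloor> ^ 2"
    unfolding Let_def floor_divide_of_nat_eq
    by (rule C_count_formula) (use assms in auto)
next
  fix y assume y: "zero_sequence d b y"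
  have C: "C_count b u w k y n = C_count b u w k x n" if "w \<subseteq> u" for w
    using C_count_formula[OF assms(2) y that assms(7), of k n]
      C_count_formula[OF assms(2,3) that assms(7), of k n] by linarith
  show G: "G_tilde b u k y n = G_tilde b u k x n"
    unfolding G_tilde_eq_sum_C_count[OF assms(2) y assms(7)]
      G_tilde_eq_sum_C_count[OF assms(2,3,7)]
    by (rule sum.cong) (auto simp: C)
  show "gain_coefficient b u k y n = gain_coefficient b u k x n"
    by (simp add: gain_coefficient_def G)
  show "C_count b u v k y n = C_count b u v k x n"
    using C assms(6) .
qed

end
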